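(* Let $\kappa>0$, $s\ge2$, and let $X=\{x_1,\dots,x_s\}\subset B_1(0)\subset\mathbb R^3$ be a set of $s$ distinct points with minimum separation $\delta_X=\min_{j\neq k}|x_j-x_k|$. If $$\mu_X:=\frac92\frac{s^{2/3}}{\kappa\delta_X}<1,$$ then for every $\alpha=(\alpha_1,\dots,\alpha_s)\in\mathbb C^s$, $$(1-\mu_X)\|\alpha\|_2^2\le\frac1{4\pi}\int_{\mathbb S^2}\Bigl|\sum_{j=1}^s\alpha_je^{i\kappa\omega\cdot x_j}\Bigr|^2d\omega\le(1+\mu_X)\|\alpha\|_2^2 .$$ Equivalently, the Gram matrix $G_X=[K_\kappa(x_j-x_k)]_{j,k=1}^s$ satisfies $$1-\mu_X\le\lambda_{\min}(G_X)\le\lambda_{\max}(G_X)\le1+\mu_X .$$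
   Context: $K_\kappa(h)=\frac1{4\pi}\int_{\mathbb S^2}e^{i\kappa\omega\cdot h}d\omega=\frac{\sin(\kappa|h|)}{\kappa|h|}$ for $h\in\mathbb R^3$, with $K_\kappa(0)=1$. $B_1(0)$ is the open unit ball; $d\omega$ is surface measure on the unit sphere $\mathbb S^2$. *)

theory Defs
  imports
    "HOL-Analysis.Analysis"
    "Jordan_Normal_Form.Spectral_Radius"
begin

text \<open>Surface measure on the unit sphere of a Euclidean space of dimension \<open>n\<close>, as it arises from
  integration in polar coordinates: the area of a Borel set \<open>E\<close> of unit vectors is \<open>n\<close> times the
  Lebesgue measure of the cone of all \<open>r *\<^sub>R \<omega>\<close> with \<open>0 < r < 1\<close> and \<open>\<omega> \<in> E\<close>.\<close>

definition sphere_measure :: "'a::euclidean_space measure" where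
  "sphere_measure =
     scale_measure (of_nat DIM('a))
       (distr (restrict_space lborel (ball 0 1 - {0})) (restrict_space borel (sphere 0 1))
          (\<lambda>x. x /\<^sub>R norm x))"

lemma space_sphere_measure: "space sphere_measure = sphere 0 1"
  by (simp add: sphere_measure_def space_restrict_space space_scale_measure)

lemma sets_sphere_measure: "sets sphere_measure = sets (restrict_space borel (sphere 0 1))"
  by (simp add: sphere_measure_def)

lemma measurable_radial_projection:
  "(\<lambda>x::'a::euclidean_space. x /\<^sub>R norm x)
     \<in> measurable (restrict_space lborel (ball 0 1 - {0})) (restrict_space borel (sphere 0 1))"
  by (rule measurable_restrict_space2)
     (auto simp: space_restrict_space intro!: measurable_restrict_space1)

lemma emeasure_sphere_measure:
  fixes E :: "'a::euclidean_space set"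
  assumes "E \<in> sets sphere_measure"
  shows "emeasure sphere_measure E =
    of_nat DIM('a) * emeasure lborel {x \<in> ball 0 1 - {0}. x /\<^sub>R norm x \<in> E}"
proof -
  have E: "E \<in> sets (restrict_space borel (sphere 0 1))"
    using assms by (simp add: sets_sphere_measure)
  have S: "(\<lambda>x. x /\<^sub>R norm x) -` E \<inter> (ball 0 1 - {0}) = {x \<in> ball 0 1 - {0}. x /\<^sub>R norm x \<in> E}"
    by auto
  have "emeasure sphere_measure E = of_nat DIM('a) *
      emeasure (restrict_space lborel (ball 0 1 - {0})) {x \<in> ball 0 1 - {0}. x /\<^sub>R norm x \<in> E}"
    using E by (simp only: sphere_measure_def emeasure_scale_measure
      emeasure_distr[OF measurable_radial_projection] space_restrict_space space_lborel space_borel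
      Int_UNIV_right sets_distr S)
  also have "\<dots> = of_nat DIM('a) * emeasure lborel {x \<in> ball 0 1 - {0}. x /\<^sub>R norm x \<in> E}"
    by (subst emeasure_restrict_space) auto
  finally show ?thesis .
qed

lemma emeasure_sphere_measure_total:
  "emeasure (sphere_measure :: (real^3) measure) (sphere 0 1) = ennreal (4 * pi)"
proof -
  have S: "sphere 0 1 \<in> sets (sphere_measure :: (real^3) measure)"
    using sets.top[of "sphere_measure :: (real^3) measure"] by (simp add: space_sphere_measure)
  have "{x \<in> ball 0 1 - {0}. x /\<^sub>R norm x \<in> sphere 0 1} = ball 0 1 - {0::real^3}"
    by auto
  moreover have "emeasure lborel (ball 0 1 - {0::real^3}) = emeasure lborel (ball (0::real^3) 1)"
    by (rule emeasure_Diff_null_set) auto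
  ultimately have "emeasure sphere_measure (sphere (0::real^3) 1) =
      3 * emeasure lborel (ball (0::real^3) 1)"
    by (simp add: emeasure_sphere_measure[OF S])
  also have "\<dots> = 3 * ennreal (unit_ball_vol 3)"
    using emeasure_ball[of 1 "0::real^3"] by simp
  also have "\<dots> = ennreal (4 * pi)"
  proof -
    have "unit_ball_vol 3 = 4 / 3 * pi"
      using unit_ball_vol_3 by simp
    then show ?thesis
      by (simp flip: ennreal_mult' ennreal_numeral)
  qed
  finally show ?thesis .
qed

definition kernel :: "real \<Rightarrow> real^3 \<Rightarrow> complex" where
  "kernel \<kappa> h =
     1 / (4 * pi) * (LINT \<omega>|sphere_measure. exp (\<i> * complex_of_real (\<kappa> * (\<omega> \<bullet> h))))"

lemma kernel_0: "kernel \<kappa> 0 = 1"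
  by (simp add: kernel_def measure_def space_sphere_measure emeasure_sphere_measure_total
      scaleR_conv_of_real)

text \<open>The points \<open>x\<^sub>1, \<dots>, x\<^sub>s\<close> are \<open>x 0, \<dots>, x (s - 1)\<close>; values of \<open>x\<close> at other indices are irrelevant.\<close>

definition min_separation :: "nat \<Rightarrow> (nat \<Rightarrow> real^3) \<Rightarrow> real" where
  "min_separation s x = Min {norm (x j - x k) | j k. j < s \<and> k < s \<and> j \<noteq> k}"

definition mu :: "real \<Rightarrow> nat \<Rightarrow> (nat \<Rightarrow> real^3) \<Rightarrow> real" where
  "mu \<kappa> s x = 9 / 2 * (real s powr (2 / 3) / (\<kappa> * min_separation s x))"

definition gram :: "real \<Rightarrow> nat \<Rightarrow> (nat \<Rightarrow> real^3) \<Rightarrow> complex mat" where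
  "gram \<kappa> s x = mat s s (\<lambda>(j, k). kernel \<kappa> (x j - x k))"

text \<open>Extreme eigenvalues of a Hermitian matrix of positive dimension; all its eigenvalues are real,
  so the sets below are finite and nonempty and contain the whole spectrum.\<close>

definition lambda_min :: "complex mat \<Rightarrow> real" where
  "lambda_min A = Min {t. complex_of_real t \<in> spectrum A}"

definition lambda_max :: "complex mat \<Rightarrow> real" where
  "lambda_max A = Max {t. complex_of_real t \<in> spectrum A}"

end

theory Submission
  imports Defs
begin

text \<open>On the sphere the coordinate \<open>\<omega> \<bullet> e\<close> along a unit vector is uniformly distributed on \<open>[-1, 1]\<close>
  (Archimedes), so \<open>kernel \<kappa> h = sin (\<kappa> |h|) / (\<kappa> |h|)\<close> and its modulus is at most \<open>1 / (\<kappa> |h|)\<close>.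
  By Schur's test the off-diagonal part of the Gram matrix is then bounded by the largest value of
  \<open>\<Sum>k\<noteq>j. 1 / (\<kappa> |x j - x k|)\<close>. Packing of balls shows that \<open>n\<close> points within distance \<open>r \<ge> \<delta>\<close> of
  \<open>x j\<close> satisfy \<open>n \<le> (3 r / \<delta>)\<^sup>3\<close>; hence the \<open>n\<close>-th nearest point, \<open>x j\<close> included, contributes at most
  \<open>3 / (\<kappa> \<delta> n\<^bsup>1/3\<^esup>)\<close>, and these terms sum to at most \<open>9/2 s\<^bsup>2/3\<^esup> / (\<kappa> \<delta>)\<close>.\<close>

section \<open>Packing of separated points and sums of inverse distances\<close>

text \<open>Balls of radius \<open>d / 2\<close> about the points are disjoint and lie in the ball
  of radius \<open>r + d / 2\<close> about \<open>c\<close>. Comparing volumes bounds the count by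
  \<open>((r + d / 2) / (d / 2)) ^ 3\<close>, and \<open>d \<le> r\<close> gives
  \<open>r + d / 2 \<le> 3 * r / 2\<close>.\<close>

lemma card_le_of_separated:
  fixes A :: "(real^3) set"
  assumes "finite A" and "0 < d" and "d \<le> r"
    and sep: "\<And>a b. a \<in> A \<Longrightarrow> b \<in> A \<Longrightarrow> a \<noteq> b \<Longrightarrow> d \<le> dist a b"
    and sub: "A \<subseteq> cball c r"
  shows "real (card A) \<le> (3 * r / d) ^ 3"
proof -
  have dis: "disjoint_family_on (\<lambda>a. ball a (d / 2)) A"
  proof (unfold disjoint_family_on_def, intro ballI impI)
    fix a b assume "a \<in> A" "b \<in> A" "a \<noteq> b"
    then show "ball a (d / 2) \<inter> ball b (d / 2) = {}"
      using sep by (intro disjoint_ballI) auto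
  qed
  have "(\<Union>a\<in>A. ball a (d / 2)) \<subseteq> cball c (r + d / 2)"
  proof
    fix y assume "y \<in> (\<Union>a\<in>A. ball a (d / 2))"
    then obtain a where "a \<in> A" "dist a y < d / 2" by auto
    moreover have "dist c a \<le> r" using sub \<open>a \<in> A\<close> by auto
    ultimately show "y \<in> cball c (r + d / 2)"
      using dist_triangle[of c y a] by simp
  qed
  then have "measure lborel (\<Union>a\<in>A. ball a (d / 2)) \<le> measure lborel (cball c (r + d / 2))"
    by (intro measure_mono_fmeasurable) (auto intro!: fmeasurableI emeasure_lborel_cball_finite borel_open)
  also have "measure lborel (\<Union>a\<in>A. ball a (d / 2)) = (\<Sum>a\<in>A. measure lborel (ball a (d / 2)))"
    using \<open>finite A\<close> dis \<open>0 < d\<close> by (intro measure_finite_Union) (auto simp: emeasure_ball)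
  also have "\<dots> = real (card A) * (unit_ball_vol 3 * (d / 2) ^ 3)"
    using \<open>0 < d\<close> by (simp add: content_ball)
  also have "measure lborel (cball c (r + d / 2)) = unit_ball_vol 3 * (r + d / 2) ^ 3"
    using assms(2,3) by (simp add: content_cball)
  finally have "unit_ball_vol 3 * (real (card A) * (d / 2) ^ 3) \<le> unit_ball_vol 3 * (r + d / 2) ^ 3"
    by (simp add: ac_simps)
  moreover have "unit_ball_vol 3 > 0" by simp
  ultimately have "real (card A) * (d / 2) ^ 3 \<le> (r + d / 2) ^ 3"
    by (meson mult_le_cancel_left_pos)
  also have "\<dots> \<le> (3 * r / 2) ^ 3"
    using assms(2,3) by (intro power_mono) auto
  finally show ?thesis
    using \<open>0 < d\<close> by (simp add: field_simps power3_eq_cube)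
qed

text \<open>The function \<open>9 / 2 * n powr (2 / 3)\<close> is concave with derivative
  \<open>3 / n powr (1 / 3)\<close>, so its increment over the last unit step dominates the
  derivative at \<open>n\<close>. In this form the contributions of the points telescope.\<close>

lemma powr_two_thirds_step:
  fixes n :: real
  assumes "1 \<le> n"
  shows "3 / n powr (1 / 3) \<le> 9 / 2 * (n powr (2 / 3) - (n - 1) powr (2 / 3))"
proof -
  define a b where "a = n powr (1 / 3)" and "b = (n - 1) powr (1 / 3)"
  have cube: "(y powr (1 / 3)) ^ 3 = y" "y powr (2 / 3) = (y powr (1 / 3)) ^ 2" if "0 \<le> y" for y :: real
    using that by (simp_all add: powr_powr flip: powr_numeral)
  have "0 < a" "0 \<le> b" "a ^ 3 = n" "b ^ 3 = n - 1"
    using assms by (auto simp: a_def b_def cube)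
  \<comment> \<open>This cubic, with a double zero at \<open>a = b\<close>, is
    \<open>3 * a * (a^2 - b^2) - 2 * (a^3 - b^3)\<close>. Since \<open>a^3 - b^3 = 1\<close>, the
    claim follows on dividing by \<open>a\<close>.\<close>
  moreover have "0 \<le> (a - b)\<^sup>2 * (a + 2 * b)"
    using \<open>0 < a\<close> \<open>0 \<le> b\<close> by simp
  moreover have "(a - b)\<^sup>2 * (a + 2 * b) = a ^ 3 - 3 * a * b\<^sup>2 + 2 * b ^ 3"
    by (simp add: algebra_simps power3_eq_cube power2_eq_square)
  ultimately have "2 * (a ^ 3 - b ^ 3) \<le> 3 * a * (a\<^sup>2 - b\<^sup>2)" "a ^ 3 - b ^ 3 = 1"
    by (auto simp: algebra_simps power3_eq_cube power2_eq_square)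
  then have "3 / a \<le> 9 / 2 * (a\<^sup>2 - b\<^sup>2)"
    using \<open>0 < a\<close> by (simp add: field_simps)
  then show ?thesis
    using assms by (simp add: a_def b_def cube)
qed

text \<open>Induction by removing a farthest point \<open>b\<close> of \<open>B\<close>. All of
  \<open>insert c B\<close> lies within \<open>dist c b\<close> of \<open>c\<close>, so packing
  bounds \<open>dist c b\<close> from below, and the increment in
  \<open>powr_two_thirds_step\<close> absorbs the term of \<open>b\<close>.\<close>

lemma sum_inverse_dist_le:
  fixes B :: "(real^3) set"
  assumes "finite B" and "0 < d"
    and "\<And>a b. a \<in> insert c B \<Longrightarrow> b \<in> insert c B \<Longrightarrow> a \<noteq> b \<Longrightarrow> d \<le> dist a b" and "c \<notin> B"
  shows "(\<Sum>b\<in>B. 1 / dist c b) \<le> 9 / 2 * (real (Suc (card B)) powr (2 / 3) / d)"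
  using assms
proof (induction "card B" arbitrary: B)
  case 0
  then show ?case by simp
next
  case (Suc n)
  then have "B \<noteq> {}" by auto
  obtain b where b: "b \<in> B" and far: "\<And>a. a \<in> B \<Longrightarrow> dist c a \<le> dist c b"
  proof -
    have "Max (dist c ` B) \<in> dist c ` B" using Suc.prems(1) \<open>B \<noteq> {}\<close> by (intro Max_in) auto
    then obtain b where "b \<in> B" "Max (dist c ` B) = dist c b" by auto
    then show ?thesis using that[of b] Suc.prems(1) by (metis Max_ge finite_imageI imageI)
  qed
  \<comment> \<open>The centre is counted as well: \<open>N\<close> is the cardinality of
    \<open>insert c B\<close>, the set to which packing is applied.\<close>
  define N where "N = real (Suc (card B))"
  have N: "real (Suc n) = N - 1" "2 \<le> N" using Suc.hyps(2) by (auto simp: N_def)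
  have "d \<le> dist c b" using Suc.prems b by auto
  have "real (card (insert c B)) \<le> (3 * dist c b / d) ^ 3"
    using Suc.prems far \<open>d \<le> dist c b\<close>
    by (intro card_le_of_separated[where c = c]) (auto intro: Suc.prems(3))
  then have "N \<le> (3 * dist c b / d) ^ 3"
    using Suc.prems by (simp add: N_def)
  then have "N powr (1 / 3) \<le> ((3 * dist c b / d) ^ 3) powr (1 / 3)"
    using N by (intro powr_mono2) auto
  also have "\<dots> = 3 * dist c b / d"
    using \<open>0 < d\<close> by (simp add: powr_powr flip: powr_numeral)
  finally have "1 / dist c b \<le> 3 / N powr (1 / 3) / d"
    using \<open>0 < d\<close> \<open>d \<le> dist c b\<close> N by (simp add: divide_simps mult.commute)
  also have "\<dots> \<le> 9 / 2 * (N powr (2 / 3) - (N - 1) powr (2 / 3)) / d"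
    using powr_two_thirds_step[of N] N \<open>0 < d\<close> by (intro divide_right_mono) auto
  finally have 1: "1 / dist c b \<le> 9 / 2 * (N powr (2 / 3) / d) - 9 / 2 * ((N - 1) powr (2 / 3) / d)"
    by (simp add: right_diff_distrib diff_divide_distrib)
  have card: "card (B - {b}) = n" using Suc.hyps(2) b Suc.prems(1) by simp
  have "(\<Sum>a\<in>B - {b}. 1 / dist c a) \<le> 9 / 2 * (real (Suc (card (B - {b}))) powr (2 / 3) / d)"
    using Suc.prems card by (intro Suc.hyps(1)) auto
  then have "(\<Sum>a\<in>B - {b}. 1 / dist c a) \<le> 9 / 2 * ((N - 1) powr (2 / 3) / d)"
    unfolding card N .
  moreover have "(\<Sum>a\<in>B. 1 / dist c a) = 1 / dist c b + (\<Sum>a\<in>B - {b}. 1 / dist c a)"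
    using Suc.prems(1) b by (simp add: sum.remove)
  ultimately show ?case
    using 1 unfolding N_def by linarith
qed

section \<open>Volumes of circular sectors of the unit ball\<close>

text \<open>Prepares for Fubini: the height along the third axis is the first component of the
  triple, so slices at fixed height are planar sets. The two measures agree on boxes, hence
  everywhere.\<close>

lemma lborel_real3_eq:
  "(lborel :: (real^3) measure) =
    distr (lborel :: (real \<times> real \<times> real) measure) borel (\<lambda>(z, y1, y2). y1 *\<^sub>R axis 1 1 + y2 *\<^sub>R axis 2 1 + z *\<^sub>R axis 3 1)"
proof (rule lborel_eqI)
  have [measurable]: "(\<lambda>(z, y1, y2). y1 *\<^sub>R axis 1 1 + y2 *\<^sub>R axis 2 1 + z *\<^sub>R axis 3 1 :: real^3) \<in> borel_measurable borel"
    unfolding case_prod_beta by (intro borel_measurable_continuous_onI continuous_intros)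
  fix l u :: "real^3"
  assume "\<And>b. b \<in> Basis \<Longrightarrow> l \<bullet> b \<le> u \<bullet> b"
  then have le: "l $ i \<le> u $ i" for i
    by (metis axis_in_Basis_iff cart_eq_inner_axis insertI1 Basis_real_def)
  have prod_eq: "(\<Prod>b\<in>Basis. (u - l) \<bullet> b) = (u $ 1 - l $ 1) * (u $ 2 - l $ 2) * (u $ 3 - l $ 3)"
  proof -
    have B: "(Basis :: (real^3) set) = (\<lambda>i. axis i 1) ` UNIV"
      by (auto simp: Basis_vec_def)
    have inj: "inj (\<lambda>i :: 3. axis i (1 :: real))"
      by (simp add: inj_on_def axis_eq_axis)
    have "(\<Prod>b\<in>Basis. (u - l) \<bullet> b) = (\<Prod>i\<in>UNIV. (u - l) \<bullet> axis i 1)"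
      unfolding B prod.reindex[OF inj] o_def ..
    also have "\<dots> = (\<Prod>i\<in>UNIV. u $ i - l $ i)"
      by (simp only: cart_eq_inner_axis[symmetric] vector_minus_component)
    also have "\<dots> = (u $ 1 - l $ 1) * (u $ 2 - l $ 2) * (u $ 3 - l $ 3)"
      unfolding UNIV_3 by (simp add: mult.assoc)
    finally show ?thesis .
  qed
  have "(\<lambda>(z, y1, y2). y1 *\<^sub>R axis 1 1 + y2 *\<^sub>R axis 2 1 + z *\<^sub>R axis 3 1 :: real^3) -` box l u
      = box (l $ 3, l $ 1, l $ 2) (u $ 3, u $ 1, u $ 2)"
  proof (rule Set.set_eqI)
    fix p :: "real \<times> real \<times> real"
    obtain z y1 y2 where p: "p = (z, y1, y2)" by (cases p)
    have "y1 *\<^sub>R axis 1 1 + y2 *\<^sub>R axis 2 1 + z *\<^sub>R axis 3 1 \<in> box l u \<longleftrightarrow>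
        l $ 1 < y1 \<and> y1 < u $ 1 \<and> l $ 2 < y2 \<and> y2 < u $ 2 \<and> l $ 3 < z \<and> z < u $ 3"
      by (auto simp: mem_box_cart forall_3 axis_def)
    then show "p \<in> (\<lambda>(z, y1, y2). y1 *\<^sub>R axis 1 1 + y2 *\<^sub>R axis 2 1 + z *\<^sub>R axis 3 1) -` box l u \<longleftrightarrow>
        p \<in> box (l $ 3, l $ 1, l $ 2) (u $ 3, u $ 1, u $ 2)"
      by (auto simp: p mem_box Basis_prod_def)
  qed
  then show "emeasure (distr (lborel :: (real \<times> real \<times> real) measure) borel
      (\<lambda>(z, y1, y2). y1 *\<^sub>R axis 1 1 + y2 *\<^sub>R axis 2 1 + z *\<^sub>R axis 3 1)) (box l u) = (\<Prod>b\<in>Basis. (u - l) \<bullet> b)"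
    using le by (simp add: emeasure_distr emeasure_lborel_box_eq Basis_prod_def prod_eq)
qed simp

text \<open>In the unit ball, the height-\<open>z\<close> slice of the sector \<open>t * norm x < x $ 3\<close> is a disc of this squared
  radius: the cone bounds it for \<open>z \<le> t\<close> and the sphere for \<open>z > t\<close>.\<close>

definition slice_radius_sq :: "real \<Rightarrow> real \<Rightarrow> real" where
  "slice_radius_sq t z =
    (if 0 < z \<and> z \<le> t then z\<^sup>2 * (1 / t\<^sup>2 - 1) else if t < z \<and> z < 1 then 1 - z\<^sup>2 else 0)"

lemma slice_radius_sq_nonneg:
  assumes "0 \<le> t" and "t \<le> 1"
  shows "0 \<le> slice_radius_sq t z"
proof -
  have "0 \<le> 1 / t\<^sup>2 - 1" if "0 < t" using assms that by (simp add: power_le_one)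
  moreover have "z\<^sup>2 \<le> 1" if "t < z" "z < 1" using assms that by (simp add: power_le_one)
  ultimately show ?thesis by (auto simp: slice_radius_sq_def)
qed

text \<open>The cone part contributes \<open>pi * (t - t^3) / 3\<close> and the spherical part
  \<open>pi * (2/3 - t + t^3 / 3)\<close>; the cubic terms cancel in the sum.\<close>

lemma nn_integral_slice_radius_sq:
  assumes "0 \<le> t" and "t \<le> 1"
  shows "(\<integral>\<^sup>+z. ennreal (pi * slice_radius_sq t z) \<partial>lborel) = ennreal (2 * pi / 3 * (1 - t))"
proof -
  have pos: "0 \<le> 1 / t\<^sup>2 - 1" if "0 < t" using assms that by (simp add: power_le_one)
  have le1: "z\<^sup>2 \<le> 1" if "t \<le> z" "z \<le> 1" for z using assms that by (simp add: power_le_one)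
  have "(\<integral>\<^sup>+z. ennreal (pi * slice_radius_sq t z) \<partial>lborel) =
      (\<integral>\<^sup>+z. ennreal (pi * (z\<^sup>2 * (1 / t\<^sup>2 - 1))) * indicator {0..t} z
            + ennreal (pi * (1 - z\<^sup>2)) * indicator {t..1} z \<partial>lborel)"
  proof (rule nn_integral_cong_AE)
    show "AE z in lborel. ennreal (pi * slice_radius_sq t z) =
        ennreal (pi * (z\<^sup>2 * (1 / t\<^sup>2 - 1))) * indicator {0..t} z
            + ennreal (pi * (1 - z\<^sup>2)) * indicator {t..1} z"
      \<comment> \<open>The two closed intervals share the endpoint \<open>t\<close>, where both
        indicators are 1; away from it the identity holds pointwise.\<close>
      using AE_lborel_singleton[of t]
      by eventually_elim (use assms in \<open>auto simp: slice_radius_sq_def split: split_indicator\<close>)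
  qed
  also have "\<dots> = (\<integral>\<^sup>+z. ennreal (pi * (z\<^sup>2 * (1 / t\<^sup>2 - 1))) * indicator {0..t} z \<partial>lborel)
      + (\<integral>\<^sup>+z. ennreal (pi * (1 - z\<^sup>2)) * indicator {t..1} z \<partial>lborel)"
    by (intro nn_integral_add) auto
  also have "(\<integral>\<^sup>+z. ennreal (pi * (z\<^sup>2 * (1 / t\<^sup>2 - 1))) * indicator {0..t} z \<partial>lborel)
      = ennreal (pi * (t ^ 3 / 3 * (1 / t\<^sup>2 - 1)) - pi * (0 ^ 3 / 3 * (1 / t\<^sup>2 - 1)))"
  proof (rule nn_integral_FTC_Icc)
    fix z :: real
    show "((\<lambda>z. pi * (z ^ 3 / 3 * (1 / t\<^sup>2 - 1))) has_real_derivative pi * (z\<^sup>2 * (1 / t\<^sup>2 - 1))) (at z)"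
      by (auto intro!: derivative_eq_intros)
    \<comment> \<open>For \<open>t = 0\<close> the quotient \<open>1 / t^2\<close> is 0 and the
      second factor is negative, but then only \<open>z = 0\<close> remains.\<close>
    show "0 \<le> pi * (z\<^sup>2 * (1 / t\<^sup>2 - 1))" if "z \<in> {0..t}"
      using pos that by (cases "t = 0") auto
  qed (use assms in auto)
  also have "(\<integral>\<^sup>+z. ennreal (pi * (1 - z\<^sup>2)) * indicator {t..1} z \<partial>lborel)
      = ennreal (pi * (1 - 1 ^ 3 / 3) - pi * (t - t ^ 3 / 3))"
  proof (rule nn_integral_FTC_Icc)
    fix z :: real
    show "((\<lambda>z. pi * (z - z ^ 3 / 3)) has_real_derivative pi * (1 - z\<^sup>2)) (at z)"
      by (auto intro!: derivative_eq_intros)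
    show "0 \<le> pi * (1 - z\<^sup>2)" if "z \<in> {t..1}"
      using le1 that by simp
  qed (use assms in auto)
  also have "ennreal (pi * (t ^ 3 / 3 * (1 / t\<^sup>2 - 1)) - pi * (0 ^ 3 / 3 * (1 / t\<^sup>2 - 1)))
      + ennreal (pi * (1 - 1 ^ 3 / 3) - pi * (t - t ^ 3 / 3)) = ennreal (2 * pi / 3 * (1 - t))"
  proof -
    have k: "pi * (t ^ 3 / 3 * (1 / t\<^sup>2 - 1)) - pi * (0 ^ 3 / 3 * (1 / t\<^sup>2 - 1)) = pi * ((t - t ^ 3) / 3)"
      by (simp add: power3_eq_cube power2_eq_square field_simps)
    have "t ^ 3 \<le> t"
      using power_decreasing[of 1 3 t] assms by simp
    moreover have "t - t ^ 3 / 3 \<le> 1 - 1 / 3"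
    proof -
      \<comment> \<open>Three times the difference of the two sides, which has a double zero at
        \<open>t = 1\<close>. Nonnegativity of both parts is what allows the \<open>ennreal\<close>
        sums to be merged.\<close>
      have "0 \<le> (1 - t)\<^sup>2 * (2 + t)" using assms by simp
      also have "\<dots> = 2 - 3 * t + t ^ 3" by (simp add: algebra_simps power3_eq_cube power2_eq_square)
      finally show ?thesis by simp
    qed
    ultimately have "0 \<le> pi * ((t - t ^ 3) / 3)" "0 \<le> pi * (1 - 1 ^ 3 / 3) - pi * (t - t ^ 3 / 3)"
      by (auto simp flip: right_diff_distrib)
    then show ?thesis
      unfolding k by (simp only: ennreal_plus[symmetric])
        (rule arg_cong[where f = ennreal], simp add: field_simps)
  qed
  finally show ?thesis .
qed

text \<open>Here \<open>n\<close> is the squared distance from the axis. For \<open>t > 0\<close>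
  and heights \<open>0 < z < 1\<close> the squared radius is the smaller of the sphere bound
  \<open>1 - z^2\<close> and the cone bound \<open>z^2 * (1 / t^2 - 1)\<close>, which cross at
  \<open>z = t\<close>; so a point of the open disc meets both.\<close>

lemma less_slice_radius_sqD:
  assumes "0 \<le> n" "0 \<le> t" and n: "n < slice_radius_sq t z"
  shows "n < 1 - z\<^sup>2 \<and> 0 < z \<and> t\<^sup>2 * n < z\<^sup>2 * (1 - t\<^sup>2)"
proof (cases "0 < z \<and> z \<le> t")
  case True
  then have n': "n < z\<^sup>2 * (1 / t\<^sup>2 - 1)" using n by (simp add: slice_radius_sq_def)
  also have "\<dots> = z\<^sup>2 / t\<^sup>2 - z\<^sup>2" by (simp add: algebra_simps)
  also have "z\<^sup>2 / t\<^sup>2 \<le> 1" using True by (simp add: power_mono)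
  finally show ?thesis using n' True by (simp add: field_simps)
next
  case False
  then have z: "t < z" "z < 1" "n < 1 - z\<^sup>2"
    using n \<open>0 \<le> n\<close> by (auto simp: slice_radius_sq_def split: if_splits)
  then have "t\<^sup>2 * n \<le> t\<^sup>2 * (1 - z\<^sup>2)" "t\<^sup>2 < z\<^sup>2"
    using \<open>0 \<le> t\<close> by (auto intro!: mult_left_mono power_strict_mono)
  then show ?thesis using z \<open>0 \<le> t\<close> by (simp add: algebra_simps)
qed

text \<open>The converse for the closed sector. Height 0 is excluded because for
  \<open>t = 0\<close> the slice there is a full unit disc, while
  \<open>slice_radius_sq 0 0 = 0\<close>.\<close>

lemma le_slice_radius_sqI:
  assumes "0 \<le> n" "0 \<le> t" "z \<noteq> 0" "n < 1 - z\<^sup>2" "0 \<le> z" "t\<^sup>2 * n \<le> z\<^sup>2 * (1 - t\<^sup>2)"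
  shows "n \<le> slice_radius_sq t z"
proof (cases "z \<le> t")
  case True
  then show ?thesis using assms by (simp add: slice_radius_sq_def field_simps)
next
  case False
  have "z < 1" using assms by (smt (verit) one_le_power)
  then show ?thesis using False assms by (simp add: slice_radius_sq_def)
qed

text \<open>The set \<open>S\<close> may contain any part of the boundary cone; the closed sector is needed to treat
  negative \<open>t\<close> by complementation.\<close>

lemma emeasure_cap_axis:
  fixes S :: "(real^3) set"
  assumes "0 \<le> t" and "t \<le> 1" and S: "S \<in> sets borel"
    and lower: "{x \<in> ball 0 1. t * norm x < x $ 3} \<subseteq> S"
    and upper: "S \<subseteq> {x \<in> ball 0 1. t * norm x \<le> x $ 3}"
  shows "emeasure lborel S = ennreal (2 * pi / 3 * (1 - t))"
proof -
  let ?\<phi> = "\<lambda>(z, y1, y2). y1 *\<^sub>R axis 1 1 + y2 *\<^sub>R axis 2 1 + z *\<^sub>R axis 3 1 :: real^3"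
  have [measurable]: "?\<phi> \<in> borel_measurable borel"
    unfolding case_prod_beta by (intro borel_measurable_continuous_onI continuous_intros)
  have norm: "norm (?\<phi> (z, y)) = sqrt (z\<^sup>2 + (norm y)\<^sup>2)" and comp: "?\<phi> (z, y) $ 3 = z" for z y
    by (cases y; simp add: norm_vec_def L2_set_def sum_3 axis_def norm_Pair add_ac)+
  have mem: "?\<phi> (z, y) \<in> ball 0 1 \<longleftrightarrow> (norm y)\<^sup>2 < 1 - z\<^sup>2"
    and lt: "t * norm (?\<phi> (z, y)) < ?\<phi> (z, y) $ 3 \<longleftrightarrow> 0 < z \<and> t\<^sup>2 * (norm y)\<^sup>2 < z\<^sup>2 * (1 - t\<^sup>2)"
    and le: "t * norm (?\<phi> (z, y)) \<le> ?\<phi> (z, y) $ 3 \<longleftrightarrow> 0 \<le> z \<and> t\<^sup>2 * (norm y)\<^sup>2 \<le> z\<^sup>2 * (1 - t\<^sup>2)"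
    for z y
  proof -
    show "?\<phi> (z, y) \<in> ball 0 1 \<longleftrightarrow> (norm y)\<^sup>2 < 1 - z\<^sup>2"
      unfolding mem_ball_0 norm by auto
    have "t * norm (?\<phi> (z, y)) = sqrt (t\<^sup>2 * (z\<^sup>2 + (norm y)\<^sup>2))"
      using \<open>0 \<le> t\<close> by (simp only: norm) (simp add: real_sqrt_mult)
    moreover have "sqrt w < z \<longleftrightarrow> 0 < z \<and> w < z\<^sup>2" "sqrt w \<le> z \<longleftrightarrow> 0 \<le> z \<and> w \<le> z\<^sup>2" if "0 \<le> w" for w
      using that by (smt (verit) real_sqrt_ge_zero real_sqrt_less_iff real_sqrt_le_iff real_sqrt_unique)+
    ultimately show "t * norm (?\<phi> (z, y)) < ?\<phi> (z, y) $ 3 \<longleftrightarrow> 0 < z \<and> t\<^sup>2 * (norm y)\<^sup>2 < z\<^sup>2 * (1 - t\<^sup>2)"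
      and "t * norm (?\<phi> (z, y)) \<le> ?\<phi> (z, y) $ 3 \<longleftrightarrow> 0 \<le> z \<and> t\<^sup>2 * (norm y)\<^sup>2 \<le> z\<^sup>2 * (1 - t\<^sup>2)"
      unfolding comp by (simp_all add: algebra_simps)
  qed
  have vim: "?\<phi> -` S \<in> sets (lborel \<Otimes>\<^sub>M lborel)"
    using measurable_sets[OF \<open>?\<phi> \<in> borel_measurable borel\<close> S]
    by (simp only: lborel_prod sets_lborel space_borel Int_UNIV_right)
  \<comment> \<open>The slice is squeezed between the open and the closed disc of the same radius,
    which have equal area.\<close>
  have slice: "emeasure lborel (Pair z -` (?\<phi> -` S)) = ennreal (pi * slice_radius_sq t z)"
    if "z \<noteq> 0" for z
  proof -
    let ?r = "sqrt (slice_radius_sq t z)"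
    have "ball 0 ?r \<subseteq> Pair z -` (?\<phi> -` S)"
    proof
      fix y :: "real \<times> real" assume "y \<in> ball 0 ?r"
      then have "sqrt ((norm y)\<^sup>2) < ?r"
        by simp
      then have "(norm y)\<^sup>2 < slice_radius_sq t z"
        by (simp only: real_sqrt_less_iff)
      then have "?\<phi> (z, y) \<in> {x \<in> ball 0 1. t * norm x < x $ 3}"
        unfolding mem_Collect_eq mem lt using less_slice_radius_sqD[of "(norm y)\<^sup>2" t z] assms by simp
      then show "y \<in> Pair z -` (?\<phi> -` S)"
        using lower by auto
    qed
    moreover have "Pair z -` (?\<phi> -` S) \<subseteq> cball 0 ?r"
    proof
      fix y assume "y \<in> Pair z -` (?\<phi> -` S)"
      then have "?\<phi> (z, y) \<in> {x \<in> ball 0 1. t * norm x \<le> x $ 3}"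
        using upper by auto
      then have "(norm y)\<^sup>2 \<le> slice_radius_sq t z"
        unfolding mem_Collect_eq mem le using le_slice_radius_sqI[of "(norm y)\<^sup>2" t z] assms that by simp
      then show "y \<in> cball 0 ?r"
        by (simp add: real_le_rsqrt)
    qed
    moreover have "emeasure lborel (ball (0 :: real \<times> real) ?r) = ennreal (pi * slice_radius_sq t z)"
      "emeasure lborel (cball (0 :: real \<times> real) ?r) = ennreal (pi * slice_radius_sq t z)"
      using slice_radius_sq_nonneg[OF assms(1,2)]
      by (simp_all add: emeasure_ball emeasure_cball unit_ball_vol_2)
    moreover have "Pair z -` (?\<phi> -` S) \<in> sets lborel"
      using vim by (rule sets_Pair1)
    ultimately show ?thesis
      using emeasure_mono[of "ball 0 ?r" "Pair z -` (?\<phi> -` S)" lborel]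
        emeasure_mono[of "Pair z -` (?\<phi> -` S)" "cball 0 ?r" lborel]
      by (simp add: antisym)
  qed
  have "emeasure lborel S = emeasure lborel (?\<phi> -` S)"
    using S by (subst lborel_real3_eq) (simp add: emeasure_distr)
  also have "\<dots> = emeasure (lborel \<Otimes>\<^sub>M lborel) (?\<phi> -` S)"
    by (simp add: lborel_prod)
  also have "\<dots> = (\<integral>\<^sup>+z. emeasure lborel (Pair z -` (?\<phi> -` S)) \<partial>lborel)"
    using vim by (rule lborel.emeasure_pair_measure_alt)
  also have "\<dots> = (\<integral>\<^sup>+z. ennreal (pi * slice_radius_sq t z) \<partial>lborel)"
    \<comment> \<open>The exceptional height 0 is a null set for the outer integral.\<close>
    by (rule nn_integral_cong_AE, use AE_lborel_singleton[of 0] in eventually_elim) (rule slice)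
  also have "\<dots> = ennreal (2 * pi / 3 * (1 - t))"
    using assms by (intro nn_integral_slice_radius_sq)
  finally show ?thesis .
qed

text \<open>Orthogonal maps preserve Lebesgue measure of sets of finite volume. Boundedness supplies
  the finiteness, and \<open>lborel\<close> and \<open>lebesgue\<close> agree on Borel sets.\<close>

lemma emeasure_orthogonal_image:
  fixes f :: "real^3 \<Rightarrow> real^3"
  assumes f: "orthogonal_transformation f" and S: "S \<in> sets borel" "bounded S" and fS: "f ` S \<in> sets borel"
  shows "emeasure lborel (f ` S) = emeasure lborel S"
proof -
  have S': "S \<in> lmeasurable" using S by (intro bounded_set_imp_lmeasurable) auto
  have "emeasure lborel A = ennreal (measure lebesgue A)" if "A \<in> lmeasurable" "A \<in> sets borel" for A :: "(real^3) set"
    using that emeasure_eq_measure2[of A lebesgue] by simp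
  then show ?thesis
    using measure_orthogonal_image[OF f S'] measurable_orthogonal_image[OF f S'] S S' fS by simp
qed

text \<open>An orthogonal map taking \<open>e\<close> to the third axis preserves norms and turns
  \<open>x \<bullet> e\<close> into the third coordinate, which reduces the claim to
  \<open>emeasure_cap_axis\<close>.\<close>

lemma emeasure_cap:
  fixes e :: "real^3" and S :: "(real^3) set"
  assumes e: "norm e = 1" and t: "0 \<le> t" "t \<le> 1" and S: "S \<in> sets borel"
    and lower: "{x \<in> ball 0 1. t * norm x < x \<bullet> e} \<subseteq> S"
    and upper: "S \<subseteq> {x \<in> ball 0 1. t * norm x \<le> x \<bullet> e}"
  shows "emeasure lborel S = ennreal (2 * pi / 3 * (1 - t))"
proof -
  obtain f :: "real^3 \<Rightarrow> real^3" where f: "orthogonal_transformation f" and fe: "f e = axis 3 1"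
    by (rule orthogonal_transformation_exists_1[OF e norm_axis_1])
  have inner: "f x $ 3 = x \<bullet> e" for x
  proof -
    have "f x $ 3 = f x \<bullet> axis 3 1" by (rule cart_eq_inner_axis)
    also have "\<dots> = x \<bullet> e" using f by (simp add: orthogonal_transformation_def flip: fe)
    finally show ?thesis .
  qed
  have norm: "norm (f x) = norm x" for x
    using f by (simp add: orthogonal_transformation_norm)
  have lin: "linear f" and bij: "bij f" 
    using f by (auto simp: orthogonal_transformation_linear orthogonal_transformation_bij)
  \<comment> \<open>Writing the image as a preimage under the continuous inverse shows that it is
    Borel.\<close>
  have img: "f ` S = inv_into UNIV f -` S"
    using bij by (simp add: bij_vimage_eq_inv_image bij_imp_bij_inv inv_inv_eq)
  have "inv_into UNIV f \<in> borel_measurable borel"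
    by (intro borel_measurable_continuous_onI linear_continuous_on linear_conv_bounded_linear[THEN iffD1]
        orthogonal_transformation_linear orthogonal_transformation_inv f)
  from measurable_sets[OF this S] have fS: "f ` S \<in> sets borel"
    by (simp add: img)
  have "emeasure lborel S = emeasure lborel (f ` S)"
    using upper by (intro emeasure_orthogonal_image[symmetric] f S fS)
      (rule bounded_subset[OF bounded_ball[of 0 1]], auto)
  also have "\<dots> = ennreal (2 * pi / 3 * (1 - t))"
  proof (rule emeasure_cap_axis[OF t fS])
    show "{x \<in> ball 0 1. t * norm x < x $ 3} \<subseteq> f ` S"
    proof
      fix x :: "real^3" assume x: "x \<in> {x \<in> ball 0 1. t * norm x < x $ 3}"
      obtain y where "x = f y" using bij by (meson bij_pointE)
      then show "x \<in> f ` S" using x lower by (auto simp: inner norm)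
    qed
    show "f ` S \<subseteq> {x \<in> ball 0 1. t * norm x \<le> x $ 3}"
      using upper by (auto simp: inner norm)
  qed
  finally show ?thesis .
qed

text \<open>For negative \<open>t\<close> the complement in the ball is the closed sector about
  \<open>- e\<close> with parameter \<open>- t\<close>, whose volume is subtracted from
  \<open>4 / 3 * pi\<close>.\<close>

lemma emeasure_open_cap:
  fixes e :: "real^3"
  assumes e: "norm e = 1" and t: "- 1 \<le> t" "t \<le> 1"
  shows "emeasure lborel {x \<in> ball 0 1. t * norm x < x \<bullet> e} = ennreal (2 * pi / 3 * (1 - t))"
proof (cases "0 \<le> t")
  case True
  then show ?thesis using assms by (intro emeasure_cap) auto
next
  case False
  let ?C = "{x \<in> ball 0 1. - t * norm x \<le> x \<bullet> (- e)}"
  have C: "?C \<in> sets borel" by measurable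
  have eC: "emeasure lborel ?C = ennreal (2 * pi / 3 * (1 - (- t)))"
    using assms False by (intro emeasure_cap[where e = "- e" and t = "- t"] C) auto
  have fin: "emeasure lborel ?C \<noteq> \<infinity>" unfolding eC by simp
  have "{x \<in> ball 0 1. t * norm x < x \<bullet> e} = ball 0 1 - ?C" by auto
  also have "emeasure lborel \<dots> = emeasure lborel (ball (0 :: real^3) 1) - emeasure lborel ?C"
    by (rule emeasure_Diff[OF fin]) (use C in simp, simp, blast)
  also have "\<dots> = ennreal (4 / 3 * pi) - ennreal (2 * pi / 3 * (1 - (- t)))"
    unfolding eC by (simp add: emeasure_ball unit_ball_vol_3)
  also have "\<dots> = ennreal (2 * pi / 3 * (1 - t))"
    using t by (subst ennreal_minus) (simp, rule arg_cong[where f = ennreal], simp add: field_simps)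
  finally show ?thesis .
qed

section \<open>Archimedes' theorem and the closed form of the kernel\<close>

lemma measurable_inner_sphere_measure:
  "(\<lambda>\<omega>. \<omega> \<bullet> e) \<in> borel_measurable (sphere_measure :: 'a::euclidean_space measure)"
  by (simp add: measurable_cong_sets[OF sets_sphere_measure refl] measurable_restrict_space1)

text \<open>The area of the cap \<open>t < \<omega> \<bullet> e\<close> is three times the volume of
  its sector, that is \<open>2 * pi * (1 - t)\<close> for \<open>t\<close> in
  \<open>[-1, 1]\<close>: a multiple of the length of \<open>{t<..1}\<close>. Finite values on all
  rays \<open>{t<..}\<close> determine the measure.\<close>

lemma distr_sphere_measure_inner:
  fixes e :: "real^3"
  assumes e: "norm e = 1"
  shows "distr sphere_measure borel (\<lambda>\<omega>. \<omega> \<bullet> e) =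
    density lborel (\<lambda>u. ennreal (2 * pi * indicator {-1..1} u))"
proof (rule measure_eqI_lessThan)
  fix t :: real
  let ?E = "{\<omega> \<in> sphere 0 1. t < \<omega> \<bullet> e}"
  have E: "?E \<in> sets (sphere_measure :: (real^3) measure)"
    using measurable_sets[OF measurable_inner_sphere_measure[of e], of "{t<..}"]
    by (simp add: space_sphere_measure vimage_def Int_def conj_commute)
  have "emeasure (distr sphere_measure borel (\<lambda>\<omega>. \<omega> \<bullet> e)) {t<..} = emeasure sphere_measure ?E"
    by (simp add: emeasure_distr[OF measurable_inner_sphere_measure] space_sphere_measure vimage_def
        Int_def conj_commute)
  also have "\<dots> = 3 * emeasure lborel {x \<in> ball 0 1 - {0}. x /\<^sub>R norm x \<in> ?E}"
    by (subst emeasure_sphere_measure[OF E]) simp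
  \<comment> \<open>Multiplying by \<open>norm x\<close> clears the projection; the origin fails the
    strict inequality on the right, matching its removal on the left.\<close>
  also have "{x \<in> ball 0 1 - {0}. x /\<^sub>R norm x \<in> ?E} = {x \<in> ball 0 1. t * norm x < x \<bullet> e}"
    by (auto simp: field_simps)
  finally have L: "emeasure (distr sphere_measure borel (\<lambda>\<omega>. \<omega> \<bullet> e)) {t<..} =
      3 * emeasure lborel {x \<in> ball 0 1. t * norm x < x \<bullet> e}" .
  have R: "emeasure (density lborel (\<lambda>u. ennreal (2 * pi * indicator {-1..1} u))) {t<..} =
      ennreal (2 * pi) * emeasure lborel ({-1..1} \<inter> {t<..})"
    by (subst emeasure_density)
      (auto simp: ennreal_mult' ennreal_indicator mult.assoc nn_integral_cmult simp flip: indicator_inter_arith)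
  \<comment> \<open>By Cauchy-Schwarz the sector is the punctured ball for \<open>t < -1\<close> and
    empty for \<open>t > 1\<close>.\<close>
  consider "t < -1" | "-1 \<le> t" "t \<le> 1" | "1 < t" by linarith
  then show eq: "emeasure (distr sphere_measure borel (\<lambda>\<omega>. \<omega> \<bullet> e)) {t<..} =
      emeasure (density lborel (\<lambda>u. ennreal (2 * pi * indicator {-1..1} u))) {t<..}"
  proof cases
    case 1
    have iff: "t * norm x < x \<bullet> e \<longleftrightarrow> x \<noteq> 0" for x
    proof -
      have "- norm x \<le> x \<bullet> e" using Cauchy_Schwarz_ineq2[of x e] e by simp
      moreover have "t * norm x < - norm x" if "x \<noteq> 0"
        using mult_strict_right_mono[of t "- 1" "norm x"] 1 that by simp
      ultimately show ?thesis by (cases "x = 0") auto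
    qed
    have "{x \<in> ball 0 1. t * norm x < x \<bullet> e} = ball 0 1 - {0}"
      unfolding iff by auto
    moreover have "emeasure lborel (ball 0 1 - {0::real^3}) = emeasure lborel (ball (0::real^3) 1)"
      by (rule emeasure_Diff_null_set) auto
    moreover have "{-1..1} \<inter> {t<..} = {-1..1}" using 1 by auto
    ultimately show ?thesis
      unfolding L R by (simp add: emeasure_ball unit_ball_vol_3 flip: ennreal_mult' ennreal_numeral)
  next
    case 2
    then have "{-1..1} \<inter> {t<..} = {t<..1}" by auto
    then show ?thesis
      unfolding L R emeasure_open_cap[OF e 2] using 2 by (simp flip: ennreal_mult' ennreal_numeral)
  next
    case 3
    have "\<not> t * norm x < x \<bullet> e" for x
    proof -
      have "x \<bullet> e \<le> norm x" using Cauchy_Schwarz_ineq2[of x e] e by simp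
      also have "\<dots> \<le> t * norm x" using 3 by (simp add: mult_le_cancel_right1)
      finally show ?thesis by simp
    qed
    moreover have "{-1..1} \<inter> {t<..} = {}" using 3 by auto
    ultimately show ?thesis unfolding L R by simp
  qed
  show "emeasure (distr sphere_measure borel (\<lambda>\<omega>. \<omega> \<bullet> e)) {t<..} < \<infinity>"
  proof -
    have "ennreal (2 * pi) * emeasure lborel ({-1..1} \<inter> {t<..}) \<le> ennreal (2 * pi) * emeasure lborel {-1..1::real}"
      by (intro mult_left_mono emeasure_mono) auto
    also have "\<dots> < \<infinity>" by (simp add: ennreal_mult_less_top)
    finally show ?thesis unfolding eq R .
  qed
qed auto

text \<open>Archimedes' theorem turns the surface integral into \<open>2 * pi\<close> times the
  integral of \<open>exp (i a u)\<close> over \<open>[-1, 1]\<close>, where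
  \<open>a = \<kappa> * norm h\<close>.\<close>

lemma kernel_eq_sinc:
  assumes "\<kappa> \<noteq> 0" and "h \<noteq> 0"
  shows "kernel \<kappa> h = complex_of_real (sin (\<kappa> * norm h) / (\<kappa> * norm h))"
proof -
  define a where "a = \<kappa> * norm h"
  have "a \<noteq> 0" using assms by (simp add: a_def)
  define e where "e = h /\<^sub>R norm h"
  have e: "norm e = 1" using assms by (simp add: e_def)
  have "(LINT \<omega>|sphere_measure. exp (\<i> * complex_of_real (\<kappa> * (\<omega> \<bullet> h)))) =
      (LINT \<omega>|sphere_measure. exp (\<i> * complex_of_real (a * (\<omega> \<bullet> e))))"
  proof -
    have "\<kappa> * (\<omega> \<bullet> h) = a * (\<omega> \<bullet> e)" for \<omega>
      using assms by (simp add: a_def e_def)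
    then show ?thesis by (simp only:)
  qed
  also have "\<dots> = (LINT u|distr sphere_measure borel (\<lambda>\<omega>. \<omega> \<bullet> e). exp (\<i> * complex_of_real (a * u)))"
    by (subst integral_distr[OF measurable_inner_sphere_measure]) auto
  also have "\<dots> = (LINT u|lborel. (2 * pi * indicator {-1..1} u) *\<^sub>R exp (\<i> * complex_of_real (a * u)))"
    unfolding distr_sphere_measure_inner[OF e] by (subst integral_density) auto
  also have "\<dots> = (2 * pi) *\<^sub>R (LINT u|lborel. indicator {-1..1} u *\<^sub>R exp (\<i> * complex_of_real (a * u)))"
    by (simp flip: scaleR_scaleR)
  also have "(LINT u|lborel. indicator {-1..1} u *\<^sub>R exp (\<i> * complex_of_real (a * u))) =
      exp (\<i> * complex_of_real (a * 1)) / (\<i> * a) - exp (\<i> * complex_of_real (a * (-1))) / (\<i> * a)"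
  proof (rule integral_FTC_Icc)
    fix u :: real
    \<comment> \<open>The antiderivative is differentiated in the complex plane and then restricted
      to the real line.\<close>
    have "((\<lambda>z. exp (c * z) / c) has_field_derivative exp (c * w)) (at w)" if "c \<noteq> 0" for c w :: complex
      using that by (auto intro!: derivative_eq_intros)
    then have "((\<lambda>z. exp (\<i> * a * z) / (\<i> * a)) has_field_derivative exp (\<i> * a * of_real u)) (at (of_real u))"
      using \<open>a \<noteq> 0\<close> by simp
    from has_vector_derivative_real_field[OF this]
    show "((\<lambda>u. exp (\<i> * complex_of_real (a * u)) / (\<i> * a)) has_vector_derivative
        exp (\<i> * complex_of_real (a * u))) (at u within {-1..1})"
      by (simp add: mult.assoc)
  qed (auto intro!: continuous_intros)
  also have "\<dots> = 2 * sin (complex_of_real a) / a"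
    using \<open>a \<noteq> 0\<close> by (simp add: sin_exp_eq field_simps)
  finally show ?thesis
    by (simp add: kernel_def a_def scaleR_conv_of_real flip: sin_of_real)
qed

section \<open>The integral as a quadratic form\<close>

lemma integrable_sphere_measure:
  fixes f :: "real^3 \<Rightarrow> 'b::{banach, second_countable_topology}"
  assumes "continuous_on UNIV f"
  shows "integrable sphere_measure f"
proof -
  interpret finite_measure "sphere_measure :: (real^3) measure"
    by standard (simp add: space_sphere_measure emeasure_sphere_measure_total)
  have "compact (f ` sphere 0 1)"
    using assms by (intro compact_continuous_image compact_sphere) (auto intro: continuous_on_subset)
  then obtain B where "\<And>\<omega>. \<omega> \<in> sphere 0 1 \<Longrightarrow> norm (f \<omega>) \<le> B"
    by (metis bounded_iff compact_imp_bounded imageI)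
  moreover have "f \<in> borel_measurable sphere_measure"
    using assms
    by (simp add: measurable_cong_sets[OF sets_sphere_measure refl] measurable_restrict_space1
        borel_measurable_continuous_onI)
  ultimately show ?thesis
    by (intro integrable_const_bound[of _ B]) (auto intro!: AE_I2 simp: space_sphere_measure)
qed

text \<open>The squared modulus is the sum times its conjugate. Products of exponentials depend only
  on \<open>x j - x k\<close>, and termwise integration produces the kernel.\<close>

lemma integral_sphere_eq_quadratic_form:
  fixes x :: "nat \<Rightarrow> real^3" and \<alpha> :: "nat \<Rightarrow> complex"
  shows "complex_of_real (1 / (4 * pi) * (LINT \<omega>|sphere_measure.
      (cmod (\<Sum>j<s. \<alpha> j * exp (\<i> * complex_of_real (\<kappa> * (\<omega> \<bullet> x j)))))\<^sup>2)) =
    (\<Sum>j<s. \<Sum>k<s. \<alpha> j * cnj (\<alpha> k) * kernel \<kappa> (x j - x k))"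
proof -
  let ?E = "\<lambda>h (\<omega> :: real^3). exp (\<i> * complex_of_real (\<kappa> * (\<omega> \<bullet> h)))"
  have square: "complex_of_real ((cmod (\<Sum>j<s. \<alpha> j * ?E (x j) \<omega>))\<^sup>2) =
      (\<Sum>j<s. \<Sum>k<s. \<alpha> j * cnj (\<alpha> k) * ?E (x j - x k) \<omega>)" for \<omega>
  proof -
    have E: "?E (x j) \<omega> * cnj (?E (x k) \<omega>) = ?E (x j - x k) \<omega>" for j k
      by (simp add: exp_cnj exp_add[symmetric] inner_diff_right algebra_simps)
    have "complex_of_real ((cmod (\<Sum>j<s. \<alpha> j * ?E (x j) \<omega>))\<^sup>2) =
        (\<Sum>j<s. \<alpha> j * ?E (x j) \<omega>) * cnj (\<Sum>k<s. \<alpha> k * ?E (x k) \<omega>)"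
      by (rule complex_norm_square)
    also have "\<dots> = (\<Sum>j<s. \<Sum>k<s. \<alpha> j * cnj (\<alpha> k) * (?E (x j) \<omega> * cnj (?E (x k) \<omega>)))"
      unfolding cnj_sum sum_product complex_cnj_mult by (intro sum.cong refl) (simp only: ac_simps)
    finally show ?thesis by (simp only: E)
  qed
  have int: "integrable sphere_measure (\<lambda>\<omega>. \<alpha> j * cnj (\<alpha> k) * ?E (x j - x k) \<omega>)" for j k
    by (intro integrable_sphere_measure continuous_intros)
  have "complex_of_real (LINT \<omega>|sphere_measure. (cmod (\<Sum>j<s. \<alpha> j * ?E (x j) \<omega>))\<^sup>2) =
      (LINT \<omega>|sphere_measure. complex_of_real ((cmod (\<Sum>j<s. \<alpha> j * ?E (x j) \<omega>))\<^sup>2))"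
    by (rule integral_complex_of_real[symmetric])
  also have "\<dots> = (LINT \<omega>|sphere_measure. (\<Sum>j<s. \<Sum>k<s. \<alpha> j * cnj (\<alpha> k) * ?E (x j - x k) \<omega>))"
    by (simp only: square)
  also have "\<dots> = (\<Sum>j<s. \<Sum>k<s. \<alpha> j * cnj (\<alpha> k) * (LINT \<omega>|sphere_measure. ?E (x j - x k) \<omega>))"
    using int by (simp add: Bochner_Integration.integral_sum)
  finally have "complex_of_real (LINT \<omega>|sphere_measure. (cmod (\<Sum>j<s. \<alpha> j * ?E (x j) \<omega>))\<^sup>2) =
      (\<Sum>j<s. \<Sum>k<s. \<alpha> j * cnj (\<alpha> k) * (LINT \<omega>|sphere_measure. ?E (x j - x k) \<omega>))" .
  then show ?thesis
    unfolding of_real_mult kernel_def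
    by (simp only:) (simp add: sum_divide_distrib del: of_real_power of_real_mult)
qed

section \<open>Schur's test and the bound for the off-diagonal part\<close>

text \<open>The inequality \<open>2ab \<le> a^2 + b^2\<close> splits each term into halves carrying
  \<open>\<alpha> j\<close> and \<open>\<alpha> k\<close>. Symmetry of \<open>B\<close> makes the
  two total halves equal, and each is then controlled by row sums.\<close>

lemma schur_test_symmetric:
  fixes K :: "'i \<Rightarrow> 'i \<Rightarrow> complex" and B :: "'i \<Rightarrow> 'i \<Rightarrow> real" and \<alpha> :: "'i \<Rightarrow> complex"
  assumes "finite I"
    and bound: "\<And>j k. j \<in> I \<Longrightarrow> k \<in> I - {j} \<Longrightarrow> cmod (K j k) \<le> B j k"
    and sym: "\<And>j k. B j k = B k j"
    and row: "\<And>j. j \<in> I \<Longrightarrow> (\<Sum>k\<in>I - {j}. B j k) \<le> m"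
  shows "cmod (\<Sum>j\<in>I. \<Sum>k\<in>I - {j}. \<alpha> j * cnj (\<alpha> k) * K j k) \<le> m * (\<Sum>j\<in>I. (cmod (\<alpha> j))\<^sup>2)"
proof -
  have "cmod (\<Sum>j\<in>I. \<Sum>k\<in>I - {j}. \<alpha> j * cnj (\<alpha> k) * K j k) \<le>
      (\<Sum>j\<in>I. \<Sum>k\<in>I - {j}. (cmod (\<alpha> j))\<^sup>2 / 2 * B j k + (cmod (\<alpha> k))\<^sup>2 / 2 * B j k)"
  proof (intro sum_norm_le)
    fix j k assume jk: "j \<in> I" "k \<in> I - {j}"
    have "cmod (\<alpha> j * cnj (\<alpha> k) * K j k) \<le> (cmod (\<alpha> j) * cmod (\<alpha> k)) * B j k"
      using bound[OF jk] by (simp add: norm_mult mult_left_mono)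
    also have "\<dots> \<le> ((cmod (\<alpha> j))\<^sup>2 / 2 + (cmod (\<alpha> k))\<^sup>2 / 2) * B j k"
      using sum_squares_bound[of "cmod (\<alpha> j)" "cmod (\<alpha> k)"] order_trans[OF norm_ge_zero bound[OF jk]]
      by (intro mult_right_mono) auto
    finally show "cmod (\<alpha> j * cnj (\<alpha> k) * K j k) \<le> (cmod (\<alpha> j))\<^sup>2 / 2 * B j k + (cmod (\<alpha> k))\<^sup>2 / 2 * B j k"
      by (simp add: distrib_right)
  qed
  also have "\<dots> = (\<Sum>j\<in>I. \<Sum>k\<in>I - {j}. (cmod (\<alpha> j))\<^sup>2 / 2 * B j k)
      + (\<Sum>j\<in>I. \<Sum>k\<in>I - {j}. (cmod (\<alpha> k))\<^sup>2 / 2 * B j k)"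
    by (simp add: sum.distrib)
  also have "(\<Sum>j\<in>I. \<Sum>k\<in>I - {j}. (cmod (\<alpha> k))\<^sup>2 / 2 * B j k) =
      (\<Sum>j\<in>I. \<Sum>k\<in>I - {j}. (cmod (\<alpha> j))\<^sup>2 / 2 * B j k)"
  proof -
    \<comment> \<open>The inner range depends on \<open>j\<close>; padding with a zero on the
      diagonal makes the ranges independent, so the sums can be swapped.\<close>
    have off: "(\<Sum>k\<in>I - {j}. g k) = (\<Sum>k\<in>I. if k = j then 0 else g k)" if "j \<in> I" for j and g :: "'i \<Rightarrow> real"
      using \<open>finite I\<close> that by (subst sum.remove[OF _ that]) (auto intro: sum.cong)
    have "(\<Sum>j\<in>I. \<Sum>k\<in>I - {j}. (cmod (\<alpha> k))\<^sup>2 / 2 * B j k) =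
        (\<Sum>j\<in>I. \<Sum>k\<in>I. if k = j then 0 else (cmod (\<alpha> k))\<^sup>2 / 2 * B j k)"
      by (intro sum.cong refl off)
    also have "\<dots> = (\<Sum>k\<in>I. \<Sum>j\<in>I. if k = j then 0 else (cmod (\<alpha> k))\<^sup>2 / 2 * B j k)"
      by (rule sum.swap)
    also have "\<dots> = (\<Sum>k\<in>I. \<Sum>j\<in>I. if j = k then 0 else (cmod (\<alpha> k))\<^sup>2 / 2 * B k j)"
      by (intro sum.cong refl) (auto simp: sym)
    also have "\<dots> = (\<Sum>j\<in>I. \<Sum>k\<in>I - {j}. (cmod (\<alpha> j))\<^sup>2 / 2 * B j k)"
      by (intro sum.cong refl off[symmetric])
    finally show ?thesis .
  qed
  also have "(\<Sum>j\<in>I. \<Sum>k\<in>I - {j}. (cmod (\<alpha> j))\<^sup>2 / 2 * B j k) + \<dots> =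
      (\<Sum>j\<in>I. (cmod (\<alpha> j))\<^sup>2 * (\<Sum>k\<in>I - {j}. B j k))"
    by (simp add: sum.distrib[symmetric] sum_distrib_left mult.commute)
  also have "\<dots> \<le> (\<Sum>j\<in>I. (cmod (\<alpha> j))\<^sup>2 * m)"
    using row by (intro sum_mono mult_left_mono) auto
  also have "\<dots> = m * (\<Sum>j\<in>I. (cmod (\<alpha> j))\<^sup>2)"
    by (simp add: sum_distrib_left mult.commute)
  finally show ?thesis .
qed

lemma min_separation_properties:
  assumes "s \<ge> 2" and "inj_on x {..<s}"
  shows min_separation_pos: "0 < min_separation s x"
    and min_separation_le: "\<And>j k. j < s \<Longrightarrow> k < s \<Longrightarrow> j \<noteq> k \<Longrightarrow> min_separation s x \<le> norm (x j - x k)"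
proof -
  let ?D = "{norm (x j - x k) | j k. j < s \<and> k < s \<and> j \<noteq> k}"
  have "?D \<subseteq> (\<lambda>(j, k). norm (x j - x k)) ` ({..<s} \<times> {..<s})" by auto
  then have fin: "finite ?D" by (rule finite_subset) auto
  have "norm (x 0 - x 1) \<in> ?D"
    unfolding mem_Collect_eq using assms(1) by (intro exI[of _ 0] exI[of _ 1]) simp
  then have "Min ?D \<in> ?D" using fin by (intro Min_in) auto
  then show "0 < min_separation s x"
    using assms(2) by (auto simp: min_separation_def inj_on_def)
  show "min_separation s x \<le> norm (x j - x k)" if "j < s" "k < s" "j \<noteq> k" for j k
    unfolding min_separation_def using fin that by (intro Min_le) auto
qed

text \<open>Apply \<open>sum_inverse_dist_le\<close> with centre \<open>x j\<close> to the other
  \<open>s - 1\<close> points; counting the centre gives exactly \<open>s\<close> in the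
  bound.\<close>

lemma row_sum_le_mu:
  assumes "\<kappa> > 0" and "s \<ge> 2" and inj: "inj_on x {..<s}" and j: "j < s"
  shows "(\<Sum>k\<in>{..<s} - {j}. 1 / (\<kappa> * norm (x j - x k))) \<le> mu \<kappa> s x"
proof -
  let ?B = "x ` ({..<s} - {j})"
  have inj': "inj_on x ({..<s} - {j})" using inj by (rule inj_on_subset) auto
  have card: "Suc (card ?B) = s" using j by (simp add: card_image[OF inj'])
  have "(\<Sum>b\<in>?B. 1 / dist (x j) b) \<le> 9 / 2 * (real (Suc (card ?B)) powr (2 / 3) / min_separation s x)"
  proof (rule sum_inverse_dist_le)
    fix a b assume "a \<in> insert (x j) ?B" "b \<in> insert (x j) ?B" "a \<noteq> b"
    moreover have "insert (x j) ?B \<subseteq> x ` {..<s}" using j by auto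
    ultimately have "a \<in> x ` {..<s}" "b \<in> x ` {..<s}" "a \<noteq> b" by blast+
    then obtain i k where "i < s" "k < s" "a = x i" "b = x k" "i \<noteq> k" by auto
    then show "min_separation s x \<le> dist a b"
      using min_separation_le[OF assms(2) inj] by (simp add: dist_norm)
  qed (use min_separation_pos[OF assms(2) inj] inj j in \<open>auto simp: inj_on_def\<close>)
  then have "(\<Sum>k\<in>{..<s} - {j}. 1 / norm (x j - x k)) \<le> 9 / 2 * (real s powr (2 / 3) / min_separation s x)"
    unfolding card by (simp add: sum.reindex[OF inj'] dist_norm)
  then have "(\<Sum>k\<in>{..<s} - {j}. 1 / norm (x j - x k)) / \<kappa> \<le> 9 / 2 * (real s powr (2 / 3) / min_separation s x) / \<kappa>"
    using \<open>\<kappa> > 0\<close> by (intro divide_right_mono) auto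
  then show ?thesis
    by (simp add: mu_def sum_divide_distrib mult.commute)
qed

text \<open>The diagonal contributes the squared norm since \<open>kernel \<kappa> 0 = 1\<close>.
  Off the diagonal, \<open>\<bar>sin\<bar> \<le> 1\<close> gives entry bounds whose row sums are at
  most \<open>mu \<kappa> s x\<close>.\<close>

lemma quadratic_form_bound:
  assumes "\<kappa> > 0" and "s \<ge> 2" and inj: "inj_on x {..<s}"
  shows "cmod ((\<Sum>j<s. \<Sum>k<s. \<alpha> j * cnj (\<alpha> k) * kernel \<kappa> (x j - x k))
      - complex_of_real (\<Sum>j<s. (cmod (\<alpha> j))\<^sup>2)) \<le> mu \<kappa> s x * (\<Sum>j<s. (cmod (\<alpha> j))\<^sup>2)"
proof -
  have "(\<Sum>k<s. \<alpha> j * cnj (\<alpha> k) * kernel \<kappa> (x j - x k)) = complex_of_real ((cmod (\<alpha> j))\<^sup>2)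
      + (\<Sum>k\<in>{..<s} - {j}. \<alpha> j * cnj (\<alpha> k) * kernel \<kappa> (x j - x k))" if "j < s" for j
    using that by (subst sum.remove[of _ j]) (auto simp: kernel_0 complex_norm_square simp del: of_real_power)
  then have "(\<Sum>j<s. \<Sum>k<s. \<alpha> j * cnj (\<alpha> k) * kernel \<kappa> (x j - x k))
      - complex_of_real (\<Sum>j<s. (cmod (\<alpha> j))\<^sup>2) =
      (\<Sum>j<s. \<Sum>k\<in>{..<s} - {j}. \<alpha> j * cnj (\<alpha> k) * kernel \<kappa> (x j - x k))"
    by (simp add: sum.distrib)
  also have "cmod \<dots> \<le> mu \<kappa> s x * (\<Sum>j<s. (cmod (\<alpha> j))\<^sup>2)"
  proof (rule schur_test_symmetric[where B = "\<lambda>j k. 1 / (\<kappa> * norm (x j - x k))"])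
    fix j k assume "j \<in> {..<s}" "k \<in> {..<s} - {j}"
    then have "x j - x k \<noteq> 0" using inj by (auto simp: inj_on_def)
    then have "kernel \<kappa> (x j - x k) =
        complex_of_real (sin (\<kappa> * norm (x j - x k)) / (\<kappa> * norm (x j - x k)))"
      using \<open>\<kappa> > 0\<close> by (intro kernel_eq_sinc) auto
    then show "cmod (kernel \<kappa> (x j - x k)) \<le> 1 / (\<kappa> * norm (x j - x k))"
      using \<open>\<kappa> > 0\<close> by (simp only: norm_of_real abs_divide) (simp add: abs_mult divide_right_mono)
  qed (use row_sum_le_mu[OF assms] in \<open>auto simp: norm_minus_commute\<close>)
  finally show ?thesis .
qed

section \<open>Eigenvalues of the Gram matrix\<close>

lemma eigenvalue_gram_quadratic_form:
  assumes "l \<in> spectrum (gram \<kappa> s x)"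
  obtains \<alpha> :: "nat \<Rightarrow> complex" where "0 < (\<Sum>j<s. (cmod (\<alpha> j))\<^sup>2)"
    and "(\<Sum>j<s. \<Sum>k<s. \<alpha> j * cnj (\<alpha> k) * kernel \<kappa> (x j - x k)) = l * complex_of_real (\<Sum>j<s. (cmod (\<alpha> j))\<^sup>2)"
proof -
  obtain v where v: "v \<in> carrier_vec s" "v \<noteq> 0\<^sub>v s" "gram \<kappa> s x *\<^sub>v v = l \<cdot>\<^sub>v v"
    using assms by (auto simp: spectrum_def eigenvalue_def eigenvector_def gram_def)
  have row: "(\<Sum>k<s. kernel \<kappa> (x j - x k) * vec_index v k) = l * vec_index v j" if "j < s" for j
  proof -
    have "vec_index (gram \<kappa> s x *\<^sub>v v) j = (\<Sum>k<s. kernel \<kappa> (x j - x k) * vec_index v k)"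
      using that v(1) by (auto simp: gram_def scalar_prod_def lessThan_atLeast0 intro!: sum.cong)
    then show ?thesis using v that by simp
  qed
  obtain i where i: "i < s" "vec_index v i \<noteq> 0"
    using v(1,2) by (metis carrier_vecD eq_vecI index_zero_vec)
  \<comment> \<open>The quadratic form conjugates the second coefficient, whereas the eigenvector
    equation has \<open>v\<close> there unconjugated; hence the coefficients are the conjugates of
    the entries of \<open>v\<close>.\<close>
  show ?thesis
  proof (rule that[of "\<lambda>j. cnj (vec_index v j)"])
    show "0 < (\<Sum>j<s. (cmod (cnj (vec_index v j)))\<^sup>2)"
      using i by (intro sum_pos2[of _ i]) auto
    have "(\<Sum>j<s. \<Sum>k<s. cnj (vec_index v j) * cnj (cnj (vec_index v k)) * kernel \<kappa> (x j - x k)) =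
        (\<Sum>j<s. cnj (vec_index v j) * (\<Sum>k<s. kernel \<kappa> (x j - x k) * vec_index v k))"
      by (simp add: sum_distrib_left ac_simps)
    also have "\<dots> = (\<Sum>j<s. l * (vec_index v j * cnj (vec_index v j)))"
      by (intro sum.cong refl) (simp add: row)
    also have "\<dots> = l * complex_of_real (\<Sum>j<s. (cmod (cnj (vec_index v j)))\<^sup>2)"
      by (simp add: complex_norm_square sum_distrib_left del: of_real_power)
    finally show "(\<Sum>j<s. \<Sum>k<s. cnj (vec_index v j) * cnj (cnj (vec_index v k)) * kernel \<kappa> (x j - x k)) =
        l * complex_of_real (\<Sum>j<s. (cmod (cnj (vec_index v j)))\<^sup>2)" .
  qed
qed

theorem theorem3p1:
  fixes \<kappa> :: real and s :: nat and x :: "nat \<Rightarrow> real^3"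
  assumes "\<kappa> > 0" and "s \<ge> 2"
    and "inj_on x {..<s}" and "x ` {..<s} \<subseteq> ball 0 1"
    and "mu \<kappa> s x < 1"
  shows "(\<forall>\<alpha> :: nat \<Rightarrow> complex.
      (1 - mu \<kappa> s x) * (L2_set (\<lambda>j. cmod (\<alpha> j)) {..<s})\<^sup>2
        \<le> 1 / (4 * pi) * (LINT \<omega>|sphere_measure.
              (cmod (\<Sum>j<s. \<alpha> j * exp (\<i> * complex_of_real (\<kappa> * (\<omega> \<bullet> x j)))))\<^sup>2) \<and>
      1 / (4 * pi) * (LINT \<omega>|sphere_measure.
              (cmod (\<Sum>j<s. \<alpha> j * exp (\<i> * complex_of_real (\<kappa> * (\<omega> \<bullet> x j)))))\<^sup>2)
        \<le> (1 + mu \<kappa> s x) * (L2_set (\<lambda>j. cmod (\<alpha> j)) {..<s})\<^sup>2) \<and>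
    (1 - mu \<kappa> s x \<le> lambda_min (gram \<kappa> s x) \<and>
     lambda_min (gram \<kappa> s x) \<le> lambda_max (gram \<kappa> s x) \<and>
     lambda_max (gram \<kappa> s x) \<le> 1 + mu \<kappa> s x)"
proof -
  define I :: "(nat \<Rightarrow> complex) \<Rightarrow> real" where
    "I \<alpha> = 1 / (4 * pi) * (LINT \<omega>|sphere_measure.
              (cmod (\<Sum>j<s. \<alpha> j * exp (\<i> * complex_of_real (\<kappa> * (\<omega> \<bullet> x j)))))\<^sup>2)" for \<alpha>
  define N where "N \<alpha> = (\<Sum>j<s. (cmod (\<alpha> j))\<^sup>2)" for \<alpha> :: "nat \<Rightarrow> complex"
  have I: "complex_of_real (I \<alpha>) = (\<Sum>j<s. \<Sum>k<s. \<alpha> j * cnj (\<alpha> k) * kernel \<kappa> (x j - x k))" for \<alpha>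
    unfolding I_def by (rule integral_sphere_eq_quadratic_form)
  have bound: "\<bar>I \<alpha> - N \<alpha>\<bar> \<le> mu \<kappa> s x * N \<alpha>" for \<alpha>
    \<comment> \<open>The quadratic form equals the real number \<open>I \<alpha>\<close>, so the
      bound on the complex modulus is a bound on a real absolute value.\<close>
    using quadratic_form_bound[OF assms(1-3), of \<alpha>]
    unfolding I[symmetric] N_def[symmetric] by (metis norm_of_real of_real_diff real_norm_def)
  have L2: "(L2_set (\<lambda>j. cmod (\<alpha> j)) {..<s})\<^sup>2 = N \<alpha>" for \<alpha> :: "nat \<Rightarrow> complex"
    by (simp add: L2_set_def N_def sum_nonneg)
  have quad: "(1 - mu \<kappa> s x) * (L2_set (\<lambda>j. cmod (\<alpha> j)) {..<s})\<^sup>2 \<le> I \<alpha>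
      \<and> I \<alpha> \<le> (1 + mu \<kappa> s x) * (L2_set (\<lambda>j. cmod (\<alpha> j)) {..<s})\<^sup>2" for \<alpha>
    using bound[of \<alpha>] unfolding L2 by (auto simp: algebra_simps abs_le_iff)
  \<comment> \<open>Each eigenvalue is a Rayleigh quotient \<open>I \<alpha> / N \<alpha>\<close>.
    This shows both that it is real and that it lies in the required interval.\<close>
  have spec: "\<exists>t. l = complex_of_real t \<and> 1 - mu \<kappa> s x \<le> t \<and> t \<le> 1 + mu \<kappa> s x"
    if l: "l \<in> spectrum (gram \<kappa> s x)" for l
  proof -
    obtain \<alpha> where \<alpha>: "0 < N \<alpha>" "complex_of_real (I \<alpha>) = l * complex_of_real (N \<alpha>)"
      using eigenvalue_gram_quadratic_form[OF l] unfolding N_def I by blast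
    then have "l = complex_of_real (I \<alpha> / N \<alpha>)" by (simp add: field_simps)
    moreover have "1 - mu \<kappa> s x \<le> I \<alpha> / N \<alpha>" "I \<alpha> / N \<alpha> \<le> 1 + mu \<kappa> s x"
      using bound[of \<alpha>] \<alpha>(1) by (auto simp: field_simps abs_le_iff)
    ultimately show ?thesis by blast
  qed
  let ?T = "{t. complex_of_real t \<in> spectrum (gram \<kappa> s x)}"
  have G: "gram \<kappa> s x \<in> carrier_mat s s" by (simp add: gram_def)
  have fin: "finite ?T"
    using finite_vimageI[OF card_finite_spectrum(1)[OF G], of complex_of_real]
    by (simp add: vimage_def inj_of_real)
  \<comment> \<open>The matrix has positive dimension, so it has a complex eigenvalue, which
    \<open>spec\<close> shows to be real; thus \<open>Min\<close> and \<open>Max\<close> are taken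
    over a nonempty set.\<close>
  have ne: "?T \<noteq> {}"
    using spectrum_non_empty[OF G] assms(2) spec by fastforce
  have "1 - mu \<kappa> s x \<le> t \<and> t \<le> 1 + mu \<kappa> s x" if "t \<in> ?T" for t
    using spec that by fastforce
  then have "1 - mu \<kappa> s x \<le> Min ?T" "Max ?T \<le> 1 + mu \<kappa> s x" "Min ?T \<le> Max ?T"
    using fin ne by (auto intro: order_trans[OF Min_le Max_ge])
  then show ?thesis
    using quad unfolding lambda_min_def lambda_max_def I_def by blast
qed

end
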